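(* Let $A$ be a von Neumann hyperring and $T\subseteq A$ a proper preorder. Then the natural projection $\pi\colon A\to Q_T(A)$ induces an isomorphism $A/_m(1+T)\cong Q_T(A)$.
   Context: A multiring is a tuple $(A,+,-,\cdot,0,1)$ where $(A,\cdot,1)$ is a commutative monoid, $+\colon A\times A\to\{\text{nonempty subsets of }A\}$ and $-\colon A\to A$ are functions and $0\in A$, such that for all $a,b,c,d\in A$: (1) $a\in b+c$ implies $c\in -b+a$ and $b\in a+(-c)$; (2) $a\in b+0$ iff $a=b$; (3) if $x\in g+c$ with $g\in a+b$, then there is $h\in b+c$ with $x\in a+h$; (4) $a+b=b+a$; (5) $a\cdot 0=0$; (6) $a\in b+c$ implies $ad\in bd+cd$. Sums of subsets are unions of elementwise sums; $1+T=\bigcup_{t\in T}1+t$. A hyperring is a multiring such that $x\in bd+cd$ implies $x=ad$ for some $a\in b+c$. A morphism of multirings $f$ satisfies $f(a)\in f(b)+f(c)$ whenever $a\in b+c$, and preserves $\cdot,-,0,1$; an isomorphism is a morphism with an inverse morphism. A von Neumann hyperring is a hyperring $A$ such that for all $a\in A$ there is $b\in A$ with $a=a^2b$. A preorder of $A$ is a subset $T\subseteq A$ containing all squares with $T\cdot T\subseteq T$, $T+T\subseteq T$; it is proper if $-1\notin T$. The multiring $\mathbf 3=\{-1,0,1\}$ has the usual multiplication and negation, and sum $0+x=x+0=\{x\}$, $1+1=\{1\}$, $(-1)+(-1)=\{-1\}$, $1+(-1)=(-1)+1=\{-1,0,1\}$. $\mathrm{sper}_T(A)$ is the set of multiring morphisms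 $\sigma\colon A\to\mathbf 3$ with $\sigma(T)\subseteq\{0,1\}$. For $a\in A$ let $\hat a\in\mathbf 3^{\mathrm{sper}_T(A)}$, $\hat a(\sigma)=\sigma(a)$. $Q_T(A)=\{\hat a: a\in A\}$ with $\hat a\hat b=\widehat{ab}$, $-\hat a=\widehat{-a}$, constants $\hat 0,\hat 1$, and $\hat a\in\hat b+\hat c$ iff there are $a',b',c'\in A$ with $\hat a'=\hat a$, $\hat b'=\hat b$, $\hat c'=\hat c$ and $a'\in b'+c'$; this is a multiring, and $\pi(a)=\hat a$ is a morphism. Marshall quotient: for a multiplicative set $S\subseteq A$ ($1\in S$, $SS\subseteq S$; here $S=1+T$), $A/_mS$ is the set of classes of $a\sim b\Leftrightarrow as=bt$ for some $s,t\in S$, with $\overline a\,\overline b=\overline{ab}$, $-\overline a=\overline{-a}$, and $\overline a\in\overline b+\overline c$ iff $as\in bt+cu$ for some $s,t,u\in S$. It is a multiring, and a morphism $f\colon A\to B$ with $f(S)=\{1\}$ factors uniquely through the canonical map $A\to A/_mS$; the induced map in the claim is this factorization of $\pi$. *)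

theory Defs
  imports "HOL-Algebra.Group"
begin

record 'a multiring = "'a monoid" +
  hzero :: 'a ("\<zero>\<index>")
  hadd :: "'a \<Rightarrow> 'a \<Rightarrow> 'a set" (infixl "\<boxplus>\<index>" 65)
  hneg :: "'a \<Rightarrow> 'a" ("\<boxminus>\<index> _" [81] 80)

locale multiring = comm_monoid A for A (structure) +
  assumes hzero_closed: "\<zero> \<in> carrier A"
    and hneg_closed: "a \<in> carrier A \<Longrightarrow> \<boxminus> a \<in> carrier A"
    and hadd_closed: "\<lbrakk>a \<in> carrier A; b \<in> carrier A\<rbrakk> \<Longrightarrow> a \<boxplus> b \<subseteq> carrier A"
    and hadd_nonempty: "\<lbrakk>a \<in> carrier A; b \<in> carrier A\<rbrakk> \<Longrightarrow> a \<boxplus> b \<noteq> {}"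
    and hadd_reversible:
      "\<lbrakk>a \<in> carrier A; b \<in> carrier A; c \<in> carrier A; a \<in> b \<boxplus> c\<rbrakk>
        \<Longrightarrow> c \<in> \<boxminus> b \<boxplus> a \<and> b \<in> a \<boxplus> \<boxminus> c"
    and hadd_zero: "\<lbrakk>a \<in> carrier A; b \<in> carrier A\<rbrakk> \<Longrightarrow> a \<in> b \<boxplus> \<zero> \<longleftrightarrow> a = b"
    and hadd_assoc:
      "\<lbrakk>a \<in> carrier A; b \<in> carrier A; c \<in> carrier A; g \<in> a \<boxplus> b; x \<in> g \<boxplus> c\<rbrakk>
        \<Longrightarrow> \<exists>h \<in> b \<boxplus> c. x \<in> a \<boxplus> h"
    and hadd_commute: "\<lbrakk>a \<in> carrier A; b \<in> carrier A\<rbrakk> \<Longrightarrow> a \<boxplus> b = b \<boxplus> a"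
    and mult_hzero: "a \<in> carrier A \<Longrightarrow> a \<otimes> \<zero> = \<zero>"
    and hadd_mult:
      "\<lbrakk>a \<in> carrier A; b \<in> carrier A; c \<in> carrier A; d \<in> carrier A; a \<in> b \<boxplus> c\<rbrakk>
        \<Longrightarrow> a \<otimes> d \<in> b \<otimes> d \<boxplus> c \<otimes> d"

locale hyperring = multiring +
  assumes hadd_mult_converse:
    "\<lbrakk>b \<in> carrier A; c \<in> carrier A; d \<in> carrier A; x \<in> b \<otimes> d \<boxplus> c \<otimes> d\<rbrakk>
      \<Longrightarrow> \<exists>a \<in> b \<boxplus> c. x = a \<otimes> d"

locale von_neumann_hyperring = hyperring +
  assumes von_neumann: "a \<in> carrier A \<Longrightarrow> \<exists>b \<in> carrier A. a = (a \<otimes> a) \<otimes> b"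

definition multiring_hom ::
  "('a, 'm) multiring_scheme \<Rightarrow> ('b, 'n) multiring_scheme \<Rightarrow> ('a \<Rightarrow> 'b) set" where
  "multiring_hom A B = {f \<in> hom A B.
     f \<one>\<^bsub>A\<^esub> = \<one>\<^bsub>B\<^esub> \<and> f \<zero>\<^bsub>A\<^esub> = \<zero>\<^bsub>B\<^esub> \<and>
     (\<forall>a \<in> carrier A. f (\<boxminus>\<^bsub>A\<^esub> a) = \<boxminus>\<^bsub>B\<^esub> (f a)) \<and>
     (\<forall>a \<in> carrier A. \<forall>b \<in> carrier A. \<forall>c \<in> carrier A.
        a \<in> b \<boxplus>\<^bsub>A\<^esub> c \<longrightarrow> f a \<in> f b \<boxplus>\<^bsub>B\<^esub> f c)}"

definition multiring_iso ::
  "('a, 'm) multiring_scheme \<Rightarrow> ('b, 'n) multiring_scheme \<Rightarrow> ('a \<Rightarrow> 'b) set" where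
  "multiring_iso A B = {f \<in> multiring_hom A B. \<exists>g \<in> multiring_hom B A.
     (\<forall>x \<in> carrier A. g (f x) = x) \<and> (\<forall>y \<in> carrier B. f (g y) = y)}"

definition multiring_preorder :: "('a, 'm) multiring_scheme \<Rightarrow> 'a set \<Rightarrow> bool" where
  "multiring_preorder A T \<longleftrightarrow> T \<subseteq> carrier A \<and>
     (\<forall>a \<in> carrier A. a \<otimes>\<^bsub>A\<^esub> a \<in> T) \<and>
     (\<forall>s \<in> T. \<forall>t \<in> T. s \<otimes>\<^bsub>A\<^esub> t \<in> T) \<and>
     (\<forall>s \<in> T. \<forall>t \<in> T. s \<boxplus>\<^bsub>A\<^esub> t \<subseteq> T)"

definition proper_preorder :: "('a, 'm) multiring_scheme \<Rightarrow> 'a set \<Rightarrow> bool" where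
  "proper_preorder A T \<longleftrightarrow> multiring_preorder A T \<and> \<boxminus>\<^bsub>A\<^esub> \<one>\<^bsub>A\<^esub> \<notin> T"

definition one_plus :: "('a, 'm) multiring_scheme \<Rightarrow> 'a set \<Rightarrow> 'a set" where
  "one_plus A T = (\<Union>t \<in> T. \<one>\<^bsub>A\<^esub> \<boxplus>\<^bsub>A\<^esub> t)"

definition three :: "int multiring" where
  "three = \<lparr>carrier = {-1, 0, 1}, mult = (*), one = 1, hzero = 0,
     hadd = (\<lambda>x y. if x = 0 then {y} else if y = 0 then {x}
                    else if x = y then {x} else {-1, 0, 1}),
     hneg = uminus\<rparr>"

text \<open>Morphisms are taken extensional (undefined off the carrier), so that the members of
  \<open>sper A T\<close> are exactly the functions on the carrier in question.\<close>

definition sper :: "('a, 'm) multiring_scheme \<Rightarrow> 'a set \<Rightarrow> ('a \<Rightarrow> int) set" where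
  "sper A T = {\<sigma> \<in> multiring_hom A three \<inter> extensional (carrier A). \<sigma> ` T \<subseteq> {0, 1}}"

definition hat :: "('a, 'm) multiring_scheme \<Rightarrow> 'a set \<Rightarrow> 'a \<Rightarrow> ('a \<Rightarrow> int) \<Rightarrow> int" where
  "hat A T a = (\<lambda>\<sigma> \<in> sper A T. \<sigma> a)"

text \<open>Product and negation of \<open>Q\<^sub>T(A)\<close> are given pointwise; lemmas \<open>Q_quot_mult\<close> and
  \<open>Q_quot_hneg\<close> below show that they are the operations induced from \<open>A\<close>.\<close>

definition Q_quot :: "('a, 'm) multiring_scheme \<Rightarrow> 'a set \<Rightarrow> (('a \<Rightarrow> int) \<Rightarrow> int) multiring" where
  "Q_quot A T = \<lparr>carrier = hat A T ` carrier A,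
     mult = (\<lambda>F G. \<lambda>\<sigma> \<in> sper A T. F \<sigma> \<otimes>\<^bsub>three\<^esub> G \<sigma>),
     one = hat A T \<one>\<^bsub>A\<^esub>, hzero = hat A T \<zero>\<^bsub>A\<^esub>,
     hadd = (\<lambda>F G. {hat A T a |a b c. a \<in> carrier A \<and> b \<in> carrier A \<and> c \<in> carrier A \<and>
                      F = hat A T b \<and> G = hat A T c \<and> a \<in> b \<boxplus>\<^bsub>A\<^esub> c}),
     hneg = (\<lambda>F. \<lambda>\<sigma> \<in> sper A T. \<boxminus>\<^bsub>three\<^esub> (F \<sigma>))\<rparr>"

definition marshall_rel :: "('a, 'm) multiring_scheme \<Rightarrow> 'a set \<Rightarrow> ('a \<times> 'a) set" where
  "marshall_rel A S = {(a, b) \<in> carrier A \<times> carrier A. \<exists>s \<in> S. \<exists>t \<in> S. a \<otimes>\<^bsub>A\<^esub> s = b \<otimes>\<^bsub>A\<^esub> t}"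

definition marshall_class :: "('a, 'm) multiring_scheme \<Rightarrow> 'a set \<Rightarrow> 'a \<Rightarrow> 'a set" where
  "marshall_class A S a = marshall_rel A S `` {a}"

text \<open>As usual for operations on equivalence classes, the union over all representatives
  is the single class of the result; see \<open>marshall_quot_mult\<close> and
  \<open>marshall_quot_hneg\<close> below.\<close>

definition marshall_quot ::
  "('a, 'm) multiring_scheme \<Rightarrow> 'a set \<Rightarrow> 'a set multiring" where
  "marshall_quot A S = \<lparr>carrier = carrier A // marshall_rel A S,
     mult = (\<lambda>X Y. \<Union>x \<in> X. \<Union>y \<in> Y. marshall_class A S (x \<otimes>\<^bsub>A\<^esub> y)),
     one = marshall_class A S \<one>\<^bsub>A\<^esub>, hzero = marshall_class A S \<zero>\<^bsub>A\<^esub>,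
     hadd = (\<lambda>X Y. {marshall_class A S a |a b c.
               a \<in> carrier A \<and> b \<in> carrier A \<and> c \<in> carrier A \<and>
               X = marshall_class A S b \<and> Y = marshall_class A S c \<and>
               (\<exists>s \<in> S. \<exists>t \<in> S. \<exists>u \<in> S. a \<otimes>\<^bsub>A\<^esub> s \<in> b \<otimes>\<^bsub>A\<^esub> t \<boxplus>\<^bsub>A\<^esub> c \<otimes>\<^bsub>A\<^esub> u)}),
     hneg = (\<lambda>X. \<Union>x \<in> X. marshall_class A S (\<boxminus>\<^bsub>A\<^esub> x))\<rparr>"

lemma multiring_three: "multiring three"
proof -
  have "comm_monoid three"
    by (rule comm_monoidI) (auto simp: three_def)
  moreover have "\<forall>a \<in> carrier three. \<forall>b \<in> carrier three. \<forall>c \<in> carrier three.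
      (a \<in> b \<boxplus>\<^bsub>three\<^esub> c \<longrightarrow> c \<in> \<boxminus>\<^bsub>three\<^esub> b \<boxplus>\<^bsub>three\<^esub> a \<and> b \<in> a \<boxplus>\<^bsub>three\<^esub> \<boxminus>\<^bsub>three\<^esub> c) \<and>
      (\<forall>g \<in> a \<boxplus>\<^bsub>three\<^esub> b. \<forall>x \<in> g \<boxplus>\<^bsub>three\<^esub> c. \<exists>h \<in> b \<boxplus>\<^bsub>three\<^esub> c. x \<in> a \<boxplus>\<^bsub>three\<^esub> h)"
    by (simp add: three_def)
  moreover have "\<forall>a \<in> carrier three. \<forall>b \<in> carrier three. \<forall>c \<in> carrier three. \<forall>d \<in> carrier three.
      a \<in> b \<boxplus>\<^bsub>three\<^esub> c \<longrightarrow> a \<otimes>\<^bsub>three\<^esub> d \<in> b \<otimes>\<^bsub>three\<^esub> d \<boxplus>\<^bsub>three\<^esub> c \<otimes>\<^bsub>three\<^esub> d"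
    by (simp add: three_def)
  moreover have "\<forall>a \<in> carrier three. \<forall>b \<in> carrier three.
      \<boxminus>\<^bsub>three\<^esub> a \<in> carrier three \<and> a \<otimes>\<^bsub>three\<^esub> \<zero>\<^bsub>three\<^esub> = \<zero>\<^bsub>three\<^esub> \<and>
      a \<boxplus>\<^bsub>three\<^esub> b \<subseteq> carrier three \<and> a \<boxplus>\<^bsub>three\<^esub> b \<noteq> {} \<and>
      a \<boxplus>\<^bsub>three\<^esub> b = b \<boxplus>\<^bsub>three\<^esub> a \<and> (a \<in> b \<boxplus>\<^bsub>three\<^esub> \<zero>\<^bsub>three\<^esub> \<longleftrightarrow> a = b)"
    by (simp add: three_def insert_commute)
  moreover have "\<zero>\<^bsub>three\<^esub> \<in> carrier three"
    by (simp add: three_def)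
  ultimately show ?thesis
    by (intro multiring.intro multiring_axioms.intro) simp_all
qed

lemma Q_quot_mult:
  assumes "a \<in> carrier A" "b \<in> carrier A"
  shows "hat A T a \<otimes>\<^bsub>Q_quot A T\<^esub> hat A T b = hat A T (a \<otimes>\<^bsub>A\<^esub> b)"
  using assms by (auto simp: Q_quot_def hat_def sper_def multiring_hom_def hom_def intro!: restrict_ext)

lemma Q_quot_hneg:
  assumes "a \<in> carrier A"
  shows "\<boxminus>\<^bsub>Q_quot A T\<^esub> (hat A T a) = hat A T (\<boxminus>\<^bsub>A\<^esub> a)"
  using assms by (auto simp: Q_quot_def hat_def sper_def multiring_hom_def intro!: restrict_ext)

lemma marshall_relI:
  assumes "a \<otimes>\<^bsub>A\<^esub> s = b \<otimes>\<^bsub>A\<^esub> t" "a \<in> carrier A" "b \<in> carrier A" "s \<in> S" "t \<in> S"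
  shows "(a, b) \<in> marshall_rel A S"
  using assms unfolding marshall_rel_def by blast

context multiring
begin

lemma hneg_unique:
  assumes "a \<in> carrier A" "b \<in> carrier A" "\<zero> \<in> a \<boxplus> b"
  shows "b = \<boxminus> a"
  using assms hadd_reversible[of \<zero> a b] hadd_zero hneg_closed hzero_closed by blast

lemma hneg_mult:
  assumes "a \<in> carrier A" "d \<in> carrier A"
  shows "\<boxminus> a \<otimes> d = \<boxminus> (a \<otimes> d)"
proof -
  have "a \<in> \<zero> \<boxplus> a"
    using assms hadd_zero hadd_commute hzero_closed by blast
  then have "\<zero> \<in> a \<boxplus> \<boxminus> a"
    using assms hadd_reversible hzero_closed by blast
  then have "\<zero> \<otimes> d \<in> a \<otimes> d \<boxplus> \<boxminus> a \<otimes> d"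
    using assms hadd_mult hneg_closed hzero_closed by blast
  moreover have "\<zero> \<otimes> d = \<zero>"
    using assms mult_hzero m_comm hzero_closed by metis
  ultimately show ?thesis
    using assms hneg_unique hneg_closed by simp
qed

context
  fixes S
  assumes S: "S \<subseteq> carrier A" "\<one> \<in> S" "\<And>s t. \<lbrakk>s \<in> S; t \<in> S\<rbrakk> \<Longrightarrow> s \<otimes> t \<in> S"
begin

lemma equiv_marshall_rel: "equiv (carrier A) (marshall_rel A S)"
proof (rule equivI)
  show "marshall_rel A S \<subseteq> carrier A \<times> carrier A"
    by (auto simp: marshall_rel_def)
  show "refl_on (carrier A) (marshall_rel A S)"
    by (rule refl_onI) (rule marshall_relI[OF refl _ _ S(2) S(2)])
  show "sym (marshall_rel A S)"
  proof (rule symI)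
    fix a b assume "(a, b) \<in> marshall_rel A S"
    then obtain s t where "a \<in> carrier A" "b \<in> carrier A" "s \<in> S" "t \<in> S" "b \<otimes> t = a \<otimes> s"
      by (auto simp: marshall_rel_def)
    then show "(b, a) \<in> marshall_rel A S"
      by (intro marshall_relI)
  qed
  show "trans (marshall_rel A S)"
  proof (rule transI)
    fix a b c assume "(a, b) \<in> marshall_rel A S" "(b, c) \<in> marshall_rel A S"
    then obtain s t u v where *: "a \<in> carrier A" "b \<in> carrier A" "c \<in> carrier A"
      "s \<in> S" "t \<in> S" "u \<in> S" "v \<in> S" "a \<otimes> s = b \<otimes> t" "b \<otimes> u = c \<otimes> v"
      by (auto simp: marshall_rel_def)
    then have c: "s \<in> carrier A" "t \<in> carrier A" "u \<in> carrier A" "v \<in> carrier A"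
      using S(1) by auto
    have "a \<otimes> (s \<otimes> u) = (a \<otimes> s) \<otimes> u"
      using *(1) c by (simp add: m_assoc)
    also have "\<dots> = (b \<otimes> t) \<otimes> u"
      using *(8) by simp
    also have "\<dots> = (b \<otimes> u) \<otimes> t"
      using *(2) c by (simp add: m_ac)
    also have "\<dots> = (c \<otimes> v) \<otimes> t"
      using *(9) by simp
    also have "\<dots> = c \<otimes> (v \<otimes> t)"
      using *(3) c by (simp add: m_assoc)
    finally show "(a, c) \<in> marshall_rel A S"
      by (rule marshall_relI) (use *(1-7) S(3) in simp_all)
  qed
qed

lemma marshall_class_eq_iff:
  assumes "a \<in> carrier A" "b \<in> carrier A"
  shows "marshall_class A S a = marshall_class A S b \<longleftrightarrow> (a, b) \<in> marshall_rel A S"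
  unfolding marshall_class_def using equiv_marshall_rel assms by (rule eq_equiv_class_iff)

lemma marshall_quot_mult:
  assumes ab: "a \<in> carrier A" "b \<in> carrier A"
  shows "marshall_class A S a \<otimes>\<^bsub>marshall_quot A S\<^esub> marshall_class A S b =
    marshall_class A S (a \<otimes> b)"
proof -
  have "marshall_class A S (x \<otimes> y) = marshall_class A S (a \<otimes> b)"
    if "x \<in> marshall_class A S a" "y \<in> marshall_class A S b" for x y
  proof -
    from that obtain s t u v where *: "x \<in> carrier A" "y \<in> carrier A"
      "s \<in> S" "t \<in> S" "u \<in> S" "v \<in> S" "a \<otimes> s = x \<otimes> t" "b \<otimes> u = y \<otimes> v"
      by (auto simp: marshall_class_def marshall_rel_def)
    then have c: "s \<in> carrier A" "t \<in> carrier A" "u \<in> carrier A" "v \<in> carrier A"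
      using S(1) by auto
    have "(x \<otimes> y) \<otimes> (t \<otimes> v) = (x \<otimes> t) \<otimes> (y \<otimes> v)"
      using *(1,2) c by (simp add: m_ac)
    also have "\<dots> = (a \<otimes> s) \<otimes> (b \<otimes> u)"
      using * by simp
    also have "\<dots> = (a \<otimes> b) \<otimes> (s \<otimes> u)"
      using ab c by (simp add: m_ac)
    finally have "(x \<otimes> y, a \<otimes> b) \<in> marshall_rel A S"
      by (rule marshall_relI) (use *(1-6) ab S(3) in simp_all)
    then show ?thesis
      using *(1,2) ab by (simp add: marshall_class_eq_iff)
  qed
  then have "(\<Union>x \<in> marshall_class A S a. \<Union>y \<in> marshall_class A S b. marshall_class A S (x \<otimes> y)) =
      (\<Union>x \<in> marshall_class A S a. \<Union>y \<in> marshall_class A S b. marshall_class A S (a \<otimes> b))"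
    by (intro SUP_cong refl)
  moreover have "a \<in> marshall_class A S a" "b \<in> marshall_class A S b"
    using ab equiv_class_self[OF equiv_marshall_rel] by (auto simp: marshall_class_def)
  ultimately show ?thesis
    by (simp add: marshall_quot_def UN_constant) blast
qed

lemma marshall_quot_hneg:
  assumes a: "a \<in> carrier A"
  shows "\<boxminus>\<^bsub>marshall_quot A S\<^esub> (marshall_class A S a) = marshall_class A S (\<boxminus> a)"
proof -
  have "marshall_class A S (\<boxminus> x) = marshall_class A S (\<boxminus> a)"
    if "x \<in> marshall_class A S a" for x
  proof -
    from that obtain s t where *: "x \<in> carrier A" "s \<in> S" "t \<in> S" "a \<otimes> s = x \<otimes> t"
      by (auto simp: marshall_class_def marshall_rel_def)
    then have "\<boxminus> x \<otimes> t = \<boxminus> a \<otimes> s"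
      using a hneg_mult[of x t] hneg_mult[of a s] subsetD[OF S(1)] by simp
    then have "(\<boxminus> x, \<boxminus> a) \<in> marshall_rel A S"
      by (rule marshall_relI) (use *(1-3) a hneg_closed in simp_all)
    then show ?thesis
      using *(1) a hneg_closed by (simp add: marshall_class_eq_iff)
  qed
  then have "(\<Union>x \<in> marshall_class A S a. marshall_class A S (\<boxminus> x)) =
      (\<Union>x \<in> marshall_class A S a. marshall_class A S (\<boxminus> a))"
    by (intro SUP_cong refl)
  moreover have "a \<in> marshall_class A S a"
    using a equiv_class_self[OF equiv_marshall_rel] by (auto simp: marshall_class_def)
  ultimately show ?thesis
    by (simp add: marshall_quot_def UN_constant) blast
qed

end

end

end

theory Submission
  imports Defs
begin

text \<open>
  A sum in \<open>A/\<^sub>m(1+T)\<close> is a sum in \<open>A\<close> after rescaling by elements of $1+T$, and a sum in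
  \<open>Q\<^sub>T(A)\<close> is the image of a sum in \<open>A\<close>. Every sign map in \<open>sper A T\<close> is $1$ on $1+T$, so
  rescaling does not change $\hat a$. Hence the two quotients carry the same structure as soon
  as they identify the same elements: if $\sigma(a) = \sigma(b)$ for all $\sigma$, then
  $as = bt$ for some $s, t \in 1+T$. This is \<open>hat_eq_iff_marshall\<close>; the converse and the
  passage to the isomorphism are formal.

  Existence of sign maps comes from Zorn's lemma: in a hyperring, a maximal proper preorder is
  an ordering, so every proper preorder has a sign map (\<open>sper_nonempty\<close>).

  The separation result is a Positivstellensatz without exponents. Suppose that $a$ and $b$
  have the same signs. Adjoin $-ab$ to $T$ to get $V$. If $-a^2 \notin V$, then
  $\{y : a^2 y \in V\}$ is a proper preorder, and it has a sign map $\sigma$; here von Neumann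
  regularity makes the set closed under products and forces $\sigma(a) \neq 0$. But then
  $\sigma(ab) = 1$, although $\sigma(-ab) \geq 0$. So $-a^2 \in V$, that is,
  $abq \in a^2 + p$ with $p, q \in T$. Multiplying by $ac^2$, where $a = a^2c$, gives
  $at = bq'$ with $t \in 1+T$ and $q' \in T$ (lemma \<open>separation\<close>). By symmetry
  $bu = ar$ with $u \in 1+T$ and $r \in T$. Then $a(tu + rt) = atu + btu = b(tu + qu)$, writing
  $q$ for $q'$, and both $tu + rt$ and $tu + qu$ are contained in $1+T$.
\<close>

section \<open>Arithmetic in multirings\<close>

context multiring
begin

lemma hadd_in_carrier:
  "\<lbrakk>x \<in> a \<boxplus> b; a \<in> carrier A; b \<in> carrier A\<rbrakk> \<Longrightarrow> x \<in> carrier A"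
  using hadd_closed by blast

lemma hadd_zero_self: "a \<in> carrier A \<Longrightarrow> a \<in> a \<boxplus> \<zero>"
  using hadd_zero by blast

lemma zero_in_hadd_hneg: "a \<in> carrier A \<Longrightarrow> \<zero> \<in> a \<boxplus> \<boxminus> a"
  using hadd_zero_self hadd_commute hadd_reversible hzero_closed by blast

lemma hneg_hneg: "a \<in> carrier A \<Longrightarrow> \<boxminus> (\<boxminus> a) = a"
  using hneg_unique[of "\<boxminus> a" a] zero_in_hadd_hneg hadd_commute hneg_closed by metis

lemma hneg_zero: "\<boxminus> \<zero> = \<zero>"
  using hneg_unique[of \<zero> \<zero>] hadd_zero_self hzero_closed by metis

lemma hneg_mult_right: "\<lbrakk>a \<in> carrier A; d \<in> carrier A\<rbrakk> \<Longrightarrow> d \<otimes> \<boxminus> a = \<boxminus> (d \<otimes> a)"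
  using hneg_mult hneg_closed m_comm by metis

lemma hneg_hadd:
  assumes "b \<in> carrier A" "c \<in> carrier A" "a \<in> b \<boxplus> c"
  shows "\<boxminus> a \<in> \<boxminus> b \<boxplus> \<boxminus> c"
proof -
  have "x \<otimes> \<boxminus> \<one> = \<boxminus> x" if "x \<in> carrier A" for x
    using that by (simp add: hneg_mult_right)
  then show ?thesis
    using hadd_mult[of a b c "\<boxminus> \<one>"] assms hadd_in_carrier hneg_closed by simp
qed

lemma hadd_mult_left:
  assumes "b \<in> carrier A" "c \<in> carrier A" "d \<in> carrier A" "a \<in> b \<boxplus> c"
  shows "d \<otimes> a \<in> d \<otimes> b \<boxplus> d \<otimes> c"
  using hadd_mult[of a b c d] assms hadd_in_carrier m_comm by metis

lemma hadd_assoc':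
  assumes "a \<in> carrier A" "b \<in> carrier A" "c \<in> carrier A" "h \<in> b \<boxplus> c" "x \<in> a \<boxplus> h"
  shows "\<exists>g \<in> a \<boxplus> b. x \<in> g \<boxplus> c"
proof -
  have "h \<in> c \<boxplus> b" "x \<in> h \<boxplus> a"
    using assms hadd_commute hadd_in_carrier by blast+
  then obtain g where "g \<in> b \<boxplus> a" "x \<in> c \<boxplus> g"
    using hadd_assoc[of c b a h x] assms by blast
  then show ?thesis
    using assms hadd_commute hadd_in_carrier by blast
qed

lemma hadd_interchange:
  assumes carr: "a \<in> carrier A" "b \<in> carrier A" "c \<in> carrier A" "d \<in> carrier A"
    and x: "u \<in> a \<boxplus> b" "v \<in> c \<boxplus> d" "x \<in> u \<boxplus> v"
  shows "\<exists>p \<in> a \<boxplus> c. \<exists>q \<in> b \<boxplus> d. x \<in> p \<boxplus> q"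
proof -
  have uv: "u \<in> carrier A" "v \<in> carrier A"
    using carr x hadd_in_carrier by blast+
  obtain h where h: "h \<in> b \<boxplus> v" "x \<in> a \<boxplus> h"
    using hadd_assoc[of a b v u x] carr uv x by blast
  have "v \<in> d \<boxplus> c"
    using x carr hadd_commute by blast
  then obtain q where q: "q \<in> b \<boxplus> d" "h \<in> q \<boxplus> c"
    using hadd_assoc'[of b d c v h] carr h by blast
  have qc: "q \<in> carrier A"
    using q carr hadd_in_carrier by blast
  have "h \<in> c \<boxplus> q"
    using q qc carr hadd_commute by blast
  then show ?thesis
    using hadd_assoc'[of a c q h x] carr qc h q by blast
qed

section \<open>Preorders\<close>

context
  fixes T
  assumes T: "multiring_preorder A T"
begin

lemma preorder_carrier: "t \<in> T \<Longrightarrow> t \<in> carrier A"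
  and preorder_square: "a \<in> carrier A \<Longrightarrow> a \<otimes> a \<in> T"
  and preorder_mult: "\<lbrakk>s \<in> T; t \<in> T\<rbrakk> \<Longrightarrow> s \<otimes> t \<in> T"
  and preorder_hadd: "\<lbrakk>s \<in> T; t \<in> T; x \<in> s \<boxplus> t\<rbrakk> \<Longrightarrow> x \<in> T"
  using T unfolding multiring_preorder_def by blast+

lemma preorder_zero: "\<zero> \<in> T"
  using preorder_square[OF hzero_closed] mult_hzero hzero_closed by simp

lemma preorder_one: "\<one> \<in> T"
  using preorder_square[of \<one>] by simp

lemma one_plus_subset: "s \<in> one_plus A T \<Longrightarrow> s \<in> T"
  unfolding one_plus_def using preorder_hadd[OF preorder_one] by blast

lemma one_in_one_plus: "\<one> \<in> one_plus A T"
  using preorder_zero hadd_zero_self by (auto simp: one_plus_def)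

lemma one_plus_hadd:
  assumes "s \<in> one_plus A T" "t \<in> T" "x \<in> s \<boxplus> t"
  shows "x \<in> one_plus A T"
proof -
  obtain r where r: "r \<in> T" "s \<in> \<one> \<boxplus> r"
    using assms by (auto simp: one_plus_def)
  then obtain h where "h \<in> r \<boxplus> t" "x \<in> \<one> \<boxplus> h"
    using hadd_assoc[of \<one> r t s x] assms preorder_carrier by blast
  moreover from this have "h \<in> T"
    using preorder_hadd[OF r(1) assms(2)] by blast
  ultimately show ?thesis
    unfolding one_plus_def by blast
qed

lemma one_plus_mult:
  assumes "s \<in> one_plus A T" "t \<in> one_plus A T"
  shows "s \<otimes> t \<in> one_plus A T"
proof -
  obtain r where r: "r \<in> T" "s \<in> \<one> \<boxplus> r"
    using assms by (auto simp: one_plus_def)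
  have c: "r \<in> carrier A" "s \<in> carrier A" "t \<in> carrier A"
    using r assms one_plus_subset preorder_carrier by blast+
  then have "s \<otimes> t \<in> t \<boxplus> r \<otimes> t"
    using hadd_mult[of s \<one> r t] r by simp
  then show ?thesis
    using one_plus_hadd[OF assms(2) preorder_mult[OF r(1) one_plus_subset[OF assms(2)]]] by blast
qed

text \<open>Pulling a preorder back along multiplication by $a^2$ localizes it at $a$. The factor
  $a^4$ that a product of two members picks up is brought back to $a^2$ by a quasi-inverse of
  $a$.\<close>

lemma preorder_localize:
  assumes carr: "a \<in> carrier A" "c \<in> carrier A" and ac: "a = (a \<otimes> a) \<otimes> c"
  shows "multiring_preorder A {y \<in> carrier A. (a \<otimes> a) \<otimes> y \<in> T}"
  unfolding multiring_preorder_def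
proof (intro conjI ballI subsetI)
  fix x assume "x \<in> carrier A"
  then show "x \<otimes> x \<in> {y \<in> carrier A. (a \<otimes> a) \<otimes> y \<in> T}"
    using carr preorder_mult preorder_square by simp
next
  fix x y assume "x \<in> {y \<in> carrier A. (a \<otimes> a) \<otimes> y \<in> T}" "y \<in> {y \<in> carrier A. (a \<otimes> a) \<otimes> y \<in> T}"
  then have xy: "x \<in> carrier A" "y \<in> carrier A" "(a \<otimes> a) \<otimes> x \<in> T" "(a \<otimes> a) \<otimes> y \<in> T"
    by auto
  have "(((a \<otimes> a) \<otimes> x) \<otimes> ((a \<otimes> a) \<otimes> y)) \<otimes> (c \<otimes> c) \<in> T"
    using xy carr preorder_mult preorder_square by blast
  also have "(((a \<otimes> a) \<otimes> x) \<otimes> ((a \<otimes> a) \<otimes> y)) \<otimes> (c \<otimes> c) =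
      (((a \<otimes> a) \<otimes> c) \<otimes> ((a \<otimes> a) \<otimes> c)) \<otimes> (x \<otimes> y)"
    using xy carr by (simp add: m_ac)
  also have "\<dots> = (a \<otimes> a) \<otimes> (x \<otimes> y)"
    using ac by simp
  finally show "x \<otimes> y \<in> {y \<in> carrier A. (a \<otimes> a) \<otimes> y \<in> T}"
    using xy by simp
next
  fix x y z assume "x \<in> {y \<in> carrier A. (a \<otimes> a) \<otimes> y \<in> T}"
    "y \<in> {y \<in> carrier A. (a \<otimes> a) \<otimes> y \<in> T}" "z \<in> x \<boxplus> y"
  then show "z \<in> {y \<in> carrier A. (a \<otimes> a) \<otimes> y \<in> T}"
    using carr preorder_hadd hadd_mult_left[of x y "a \<otimes> a" z] hadd_in_carrier[of z x y] by auto
qed auto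

end

section \<open>Orderings from maximal proper preorders\<close>

lemma maximal_preorder_exists:
  assumes "proper_preorder A T"
  shows "\<exists>P. proper_preorder A P \<and> T \<subseteq> P \<and>
    (\<forall>Q. proper_preorder A Q \<longrightarrow> P \<subseteq> Q \<longrightarrow> Q = P)"
proof -
  let ?F = "{P. proper_preorder A P \<and> T \<subseteq> P}"
  have "\<exists>M \<in> ?F. \<forall>X \<in> ?F. M \<subseteq> X \<longrightarrow> X = M"
  proof (rule subset_Zorn_nonempty)
    show "?F \<noteq> {}"
      using assms by blast
  next
    fix C assume C: "C \<noteq> {}" "subset.chain ?F C"
    have mem: "proper_preorder A X" "T \<subseteq> X" if "X \<in> C" for X
      using C that by (auto simp: subset.chain_def)
    have two: "\<exists>X \<in> C. x \<in> X \<and> y \<in> X" if "x \<in> \<Union>C" "y \<in> \<Union>C" for x y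
      using that subset_chain_def[of ?F C] C(2) by blast
    have "multiring_preorder A (\<Union>C)"
      unfolding multiring_preorder_def
    proof (intro conjI ballI)
      show "\<Union>C \<subseteq> carrier A"
        using mem unfolding proper_preorder_def multiring_preorder_def by blast
      show "a \<otimes> a \<in> \<Union>C" if "a \<in> carrier A" for a
        using mem C that unfolding proper_preorder_def multiring_preorder_def by blast
      show "s \<otimes> t \<in> \<Union>C" if "s \<in> \<Union>C" "t \<in> \<Union>C" for s t
        using two[OF that] mem unfolding proper_preorder_def multiring_preorder_def by blast
      show "s \<boxplus> t \<subseteq> \<Union>C" if "s \<in> \<Union>C" "t \<in> \<Union>C" for s t
        using two[OF that] mem unfolding proper_preorder_def multiring_preorder_def by blast
    qed
    then show "\<Union>C \<in> ?F"
      using mem C unfolding proper_preorder_def by blast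
  qed
  then obtain M where M: "M \<in> ?F" "\<forall>X \<in> ?F. M \<subseteq> X \<longrightarrow> X = M"
    by (rule bexE)
  show ?thesis
  proof (intro exI[of _ M] conjI allI impI)
    show "proper_preorder A M" "T \<subseteq> M"
      using M(1) by simp_all
    show "Q = M" if "proper_preorder A Q" "M \<subseteq> Q" for Q
      using M that subset_trans[of T M Q] by simp
  qed
qed

text \<open>An ordering, in the form of its nonnegative cone, is a point of the real spectrum: the
  sign of an element is $0$ on the prime support \<open>P \<inter> -P\<close>, and is otherwise decided by
  membership in \<open>P\<close>.\<close>

lemma sign_of_ordering:
  assumes P: "proper_preorder A P"
    and total: "\<And>a. a \<in> carrier A \<Longrightarrow> a \<in> P \<or> \<boxminus> a \<in> P"
    and prime: "\<And>a b. \<lbrakk>a \<in> carrier A; b \<in> carrier A; \<boxminus> a \<notin> P; \<boxminus> b \<notin> P\<rbrakk> \<Longrightarrow> \<boxminus> (a \<otimes> b) \<notin> P"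
  defines "\<sigma> \<equiv> \<lambda>a \<in> carrier A. if \<boxminus> a \<notin> P then 1 else if a \<notin> P then - 1 else (0::int)"
  shows "\<sigma> \<in> sper A P"
proof -
  have pre: "multiring_preorder A P" and m1: "\<boxminus> \<one> \<notin> P"
    using P by (auto simp: proper_preorder_def)
  note pm = preorder_mult[OF pre] and pa = preorder_hadd[OF pre] and pc = preorder_carrier[OF pre]
  have pos: "\<sigma> a = 1 \<longleftrightarrow> \<boxminus> a \<notin> P" and neg: "\<sigma> a = - 1 \<longleftrightarrow> a \<notin> P"
    and null: "\<sigma> a = 0 \<longleftrightarrow> a \<in> P \<and> \<boxminus> a \<in> P" if "a \<in> carrier A" for a
    using that total[of a] by (auto simp: \<sigma>_def)
  have vals: "\<sigma> a = 1 \<or> \<sigma> a = 0 \<or> \<sigma> a = - 1" if "a \<in> carrier A" for a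
    using that by (auto simp: \<sigma>_def)
  have sneg: "\<sigma> (\<boxminus> a) = - \<sigma> a" if "a \<in> carrier A" for a
    using that total[of a] by (auto simp: \<sigma>_def hneg_hneg hneg_closed)
  have mult_pos: "\<sigma> (a \<otimes> b) = 1" if "a \<in> carrier A" "b \<in> carrier A" "\<sigma> a = 1" "\<sigma> b = 1" for a b
    using that prime[of a b] by (simp add: pos)
  have mult_zero: "\<sigma> (a \<otimes> b) = 0" if ab: "a \<in> carrier A" "b \<in> carrier A" "\<sigma> a = 0" for a b
  proof -
    have a: "a \<in> P" "\<boxminus> a \<in> P"
      using ab null by blast+
    consider "b \<in> P" | "\<boxminus> b \<in> P"
      using total ab by blast
    then show ?thesis
    proof cases
      case 1
      then have "a \<otimes> b \<in> P" "\<boxminus> a \<otimes> b \<in> P"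
        using a pm by blast+
      then show ?thesis
        using ab null by (simp add: hneg_mult)
    next
      case 2
      then have "a \<otimes> \<boxminus> b \<in> P" "\<boxminus> a \<otimes> \<boxminus> b \<in> P"
        using a pm by blast+
      then show ?thesis
        using ab null by (simp add: hneg_mult hneg_mult_right hneg_hneg hneg_closed)
    qed
  qed
  have mult: "\<sigma> (a \<otimes> b) = \<sigma> a * \<sigma> b" if ab: "a \<in> carrier A" "b \<in> carrier A" for a b
  proof -
    have n: "\<boxminus> a \<in> carrier A" "\<boxminus> b \<in> carrier A"
      using ab hneg_closed by auto
    have "\<sigma> (\<boxminus> a \<otimes> b) = - \<sigma> (a \<otimes> b)" "\<sigma> (a \<otimes> \<boxminus> b) = - \<sigma> (a \<otimes> b)"
      "\<sigma> (\<boxminus> a \<otimes> \<boxminus> b) = \<sigma> (a \<otimes> b)"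
      using ab n sneg by (simp_all add: hneg_mult hneg_mult_right hneg_hneg)
    moreover have "\<sigma> (b \<otimes> a) = \<sigma> (a \<otimes> b)"
      using ab by (simp add: m_comm)
    ultimately show ?thesis
      using vals[OF ab(1)] vals[OF ab(2)] mult_zero[OF ab] mult_zero[OF ab(2,1)]
        mult_pos[OF ab] mult_pos[OF n(1) ab(2)] mult_pos[OF ab(1) n(2)] mult_pos[OF n]
        sneg[OF ab(1)] sneg[OF ab(2)] by auto
  qed
  have add_pos: "\<sigma> a = 1"
    if bc: "b \<in> carrier A" "c \<in> carrier A" "a \<in> b \<boxplus> c" "\<sigma> b = 1" "\<sigma> c \<noteq> - 1" for a b c
  proof (rule ccontr)
    assume "\<sigma> a \<noteq> 1"
    have a: "a \<in> carrier A"
      using bc hadd_in_carrier by blast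
    then have na: "\<boxminus> a \<in> P"
      using \<open>\<sigma> a \<noteq> 1\<close> pos by blast
    have c: "c \<in> P"
      using bc neg by blast
    have "b \<in> a \<boxplus> \<boxminus> c"
      using hadd_reversible[of a b c] a bc by blast
    then have "\<boxminus> b \<in> \<boxminus> a \<boxplus> c"
      using hneg_hadd[of a "\<boxminus> c" b] a bc hneg_closed by (simp add: hneg_hneg)
    then have "\<boxminus> b \<in> P"
      using na c pa by blast
    then show False
      using bc pos by blast
  qed
  have add_neg: "\<sigma> a = - 1"
    if bc: "b \<in> carrier A" "c \<in> carrier A" "a \<in> b \<boxplus> c" "\<sigma> b = - 1" "\<sigma> c \<noteq> 1" for a b c
  proof -
    have a: "a \<in> carrier A"
      using bc hadd_in_carrier by blast
    show ?thesis
      using add_pos[of "\<boxminus> b" "\<boxminus> c" "\<boxminus> a"] bc a hneg_hadd[of b c a] hneg_closed sneg by auto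
  qed
  have add_zero: "\<sigma> a = 0"
    if bc: "b \<in> carrier A" "c \<in> carrier A" "a \<in> b \<boxplus> c" "\<sigma> b = 0" "\<sigma> c = 0" for a b c
  proof -
    have a: "a \<in> carrier A"
      using bc hadd_in_carrier by blast
    have "b \<in> P" "c \<in> P" "\<boxminus> b \<in> P" "\<boxminus> c \<in> P"
      using bc null by blast+
    then show ?thesis
      using null[OF a] pa bc hneg_hadd[of b c a] by blast
  qed
  have hadd: "\<sigma> a \<in> \<sigma> b \<boxplus>\<^bsub>three\<^esub> \<sigma> c"
    if bc: "b \<in> carrier A" "c \<in> carrier A" "a \<in> b \<boxplus> c" for a b c
  proof -
    have cb: "a \<in> c \<boxplus> b"
      using bc hadd_commute by blast
    have a: "a \<in> carrier A"
      using bc hadd_in_carrier by blast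
    show ?thesis
      using vals[OF bc(1)] vals[OF bc(2)] vals[OF a] add_pos[OF bc] add_neg[OF bc] add_zero[OF bc]
        add_pos[OF bc(2,1) cb] add_neg[OF bc(2,1) cb]
      by (auto simp: three_def)
  qed
  have "\<sigma> \<one> = 1"
    using m1 pos by simp
  moreover have "\<sigma> \<zero> = 0"
    using null[OF hzero_closed] preorder_zero[OF pre] hneg_zero by simp
  ultimately have "\<sigma> \<in> multiring_hom A three"
    using vals mult sneg hadd by (auto simp: multiring_hom_def hom_def three_def)
  moreover have "\<sigma> \<in> extensional (carrier A)"
    by (simp add: \<sigma>_def)
  moreover have "\<sigma> ` P \<subseteq> {0, 1}"
    using pc vals neg by blast
  ultimately show ?thesis
    by (simp add: sper_def)
qed

lemma sper_mono: "T \<subseteq> P \<Longrightarrow> sper A P \<subseteq> sper A T"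
  by (auto simp: sper_def)

end

definition adjoin :: "('a, 'm) multiring_scheme \<Rightarrow> 'a set \<Rightarrow> 'a \<Rightarrow> 'a set" where
  "adjoin A T a = (\<Union>s \<in> T. \<Union>t \<in> T. s \<boxplus>\<^bsub>A\<^esub> t \<otimes>\<^bsub>A\<^esub> a)"

context hyperring
begin

lemma adjoin_preorder:
  assumes T: "multiring_preorder A T" and a: "a \<in> carrier A"
  shows "multiring_preorder A (adjoin A T a)" "T \<subseteq> adjoin A T a" "a \<in> adjoin A T a"
proof -
  note pm = preorder_mult[OF T] and pa = preorder_hadd[OF T] and pc = preorder_carrier[OF T]
    and pz = preorder_zero[OF T] and po = preorder_one[OF T]
  have z: "\<zero> \<otimes> a = \<zero>"
    using a mult_hzero m_comm hzero_closed by metis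
  show sub: "T \<subseteq> adjoin A T a"
  proof
    fix s assume s: "s \<in> T"
    then have "s \<in> s \<boxplus> \<zero> \<otimes> a"
      using z hadd_zero_self pc by simp
    then show "s \<in> adjoin A T a"
      using s pz unfolding adjoin_def by blast
  qed
  have "a \<in> \<zero> \<boxplus> \<one> \<otimes> a"
    using a hadd_zero_self hadd_commute hzero_closed by (metis l_one)
  then show "a \<in> adjoin A T a"
    using pz po unfolding adjoin_def by blast
  \<comment> \<open>Collecting the multiples of \<open>a\<close> is where the full distributive law enters.\<close>
  have collect: "x \<in> adjoin A T a"
    if ptq: "p \<in> T" "t \<in> T" "t' \<in> T" "q \<in> t \<otimes> a \<boxplus> t' \<otimes> a" "x \<in> p \<boxplus> q" for p t t' q x
  proof -
    obtain w where "w \<in> t \<boxplus> t'" "q = w \<otimes> a"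
      using hadd_mult_converse[of t t' a q] ptq a pc by blast
    then show ?thesis
      using ptq pa unfolding adjoin_def by blast
  qed
  show "multiring_preorder A (adjoin A T a)"
    unfolding multiring_preorder_def
  proof (intro conjI ballI subsetI)
    fix x assume "x \<in> adjoin A T a"
    then obtain s t where "s \<in> T" "t \<in> T" "x \<in> s \<boxplus> t \<otimes> a"
      unfolding adjoin_def by blast
    then show "x \<in> carrier A"
      using hadd_in_carrier[of x s "t \<otimes> a"] pc a by simp
  next
    fix x assume "x \<in> carrier A"
    then show "x \<otimes> x \<in> adjoin A T a"
      using sub preorder_square[OF T] by blast
  next
    fix x y assume "x \<in> adjoin A T a" "y \<in> adjoin A T a"
    then obtain s t s' t' where st: "s \<in> T" "t \<in> T" "s' \<in> T" "t' \<in> T"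
      and x: "x \<in> s \<boxplus> t \<otimes> a" and y: "y \<in> s' \<boxplus> t' \<otimes> a"
      unfolding adjoin_def by blast
    have c: "s \<in> carrier A" "t \<in> carrier A" "s' \<in> carrier A" "t' \<in> carrier A"
      using st pc by auto
    have xc: "x \<in> carrier A" and yc: "y \<in> carrier A"
      using hadd_in_carrier[OF x] hadd_in_carrier[OF y] c a by simp_all
    have xy: "x \<otimes> y \<in> s \<otimes> y \<boxplus> (t \<otimes> a) \<otimes> y"
      using hadd_mult[of x s "t \<otimes> a" y] x xc yc c a by simp
    have u: "s \<otimes> y \<in> s \<otimes> s' \<boxplus> s \<otimes> (t' \<otimes> a)"
      using hadd_mult_left[of s' "t' \<otimes> a" s y] y c a by simp
    have "(t \<otimes> a) \<otimes> y \<in> (t \<otimes> a) \<otimes> s' \<boxplus> (t \<otimes> a) \<otimes> (t' \<otimes> a)"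
      using hadd_mult_left[of s' "t' \<otimes> a" "t \<otimes> a" y] y c a by simp
    then have v: "(t \<otimes> a) \<otimes> y \<in> (t \<otimes> a) \<otimes> (t' \<otimes> a) \<boxplus> (t \<otimes> a) \<otimes> s'"
      using hadd_commute c a by simp
    obtain p q where pq: "p \<in> s \<otimes> s' \<boxplus> (t \<otimes> a) \<otimes> (t' \<otimes> a)"
        "q \<in> s \<otimes> (t' \<otimes> a) \<boxplus> (t \<otimes> a) \<otimes> s'" "x \<otimes> y \<in> p \<boxplus> q"
      using hadd_interchange[OF _ _ _ _ u v xy] c a by auto
    have "(t \<otimes> a) \<otimes> (t' \<otimes> a) = (t \<otimes> t') \<otimes> (a \<otimes> a)"
      using c a by (simp add: m_ac)
    then have "p \<in> T"
      using pq st pm pa preorder_square[OF T a] by metis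
    moreover have "s \<otimes> (t' \<otimes> a) = (s \<otimes> t') \<otimes> a" "(t \<otimes> a) \<otimes> s' = (t \<otimes> s') \<otimes> a"
      using c a by (simp_all add: m_ac)
    ultimately show "x \<otimes> y \<in> adjoin A T a"
      using collect[of p "s \<otimes> t'" "t \<otimes> s'" q] pq st pm by simp
  next
    fix x y z assume "x \<in> adjoin A T a" "y \<in> adjoin A T a" and z: "z \<in> x \<boxplus> y"
    then obtain s t s' t' where st: "s \<in> T" "t \<in> T" "s' \<in> T" "t' \<in> T"
      and x: "x \<in> s \<boxplus> t \<otimes> a" and y: "y \<in> s' \<boxplus> t' \<otimes> a"
      unfolding adjoin_def by blast
    have c: "s \<in> carrier A" "t \<in> carrier A" "s' \<in> carrier A" "t' \<in> carrier A"
      using st pc by auto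
    obtain p q where "p \<in> s \<boxplus> s'" "q \<in> t \<otimes> a \<boxplus> t' \<otimes> a" "z \<in> p \<boxplus> q"
      using hadd_interchange[OF _ _ _ _ x y z] c a by auto
    then show "z \<in> adjoin A T a"
      using collect st pa by blast
  qed
qed

text \<open>Adjoining $-a$ to \<open>P\<close> produces $-1$, and the equation for $-1$ is solved for the multiple of
  $a$. So an element that is strictly positive for \<open>P\<close> is invertible up to $1+P$.\<close>

lemma maximal_preorder_inverse:
  assumes P: "proper_preorder A P"
    and max: "\<And>Q. \<lbrakk>proper_preorder A Q; P \<subseteq> Q\<rbrakk> \<Longrightarrow> Q = P"
    and a: "a \<in> carrier A" "\<boxminus> a \<notin> P"
  shows "\<exists>t \<in> P. t \<otimes> a \<in> one_plus A P"
proof -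
  have pre: "multiring_preorder A P"
    using P by (simp add: proper_preorder_def)
  have na: "\<boxminus> a \<in> carrier A"
    using a hneg_closed by blast
  have "\<boxminus> \<one> \<in> adjoin A P (\<boxminus> a)"
    using adjoin_preorder[OF pre na] max a unfolding proper_preorder_def by blast
  then obtain s t where st: "s \<in> P" "t \<in> P" "\<boxminus> \<one> \<in> s \<boxplus> t \<otimes> \<boxminus> a"
    unfolding adjoin_def by blast
  have c: "s \<in> carrier A" "t \<in> carrier A"
    using st preorder_carrier[OF pre] by auto
  have "\<one> \<in> \<boxminus> s \<boxplus> t \<otimes> a"
    using hneg_hadd[OF _ _ st(3)] c a na by (simp add: hneg_mult_right hneg_hneg hneg_closed)
  then have "t \<otimes> a \<in> \<boxminus> (\<boxminus> s) \<boxplus> \<one>"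
    using hadd_reversible[of \<one> "\<boxminus> s" "t \<otimes> a"] c a hneg_closed by simp
  then have "t \<otimes> a \<in> \<one> \<boxplus> s"
    using c hadd_commute by (simp add: hneg_hneg)
  then show ?thesis
    using st unfolding one_plus_def by blast
qed

text \<open>A maximal proper preorder is an ordering with prime support: strictly positive elements
  become members of $1+P$ after scaling by \<open>P\<close>, the set $1+P$ is closed under products, and no
  negative of a member of $1+P$ lies in \<open>P\<close>, because $-1 \notin P$.\<close>

lemma sper_nonempty:
  assumes "proper_preorder A T"
  shows "sper A T \<noteq> {}"
proof -
  obtain P where P: "proper_preorder A P" "T \<subseteq> P"
    and max: "\<And>Q. \<lbrakk>proper_preorder A Q; P \<subseteq> Q\<rbrakk> \<Longrightarrow> Q = P"
    using maximal_preorder_exists[OF assms] by (elim exE conjE) simp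
  have pre: "multiring_preorder A P" and m1: "\<boxminus> \<one> \<notin> P"
    using P by (auto simp: proper_preorder_def)
  have prime: "\<boxminus> (a \<otimes> b) \<notin> P"
    if ab: "a \<in> carrier A" "b \<in> carrier A" "\<boxminus> a \<notin> P" "\<boxminus> b \<notin> P" for a b
  proof
    assume neg: "\<boxminus> (a \<otimes> b) \<in> P"
    obtain s t where st: "s \<in> P" "s \<otimes> a \<in> one_plus A P" "t \<in> P" "t \<otimes> b \<in> one_plus A P"
      using maximal_preorder_inverse[OF P(1) max] ab by meson
    have c: "s \<in> carrier A" "t \<in> carrier A"
      using st preorder_carrier[OF pre] by auto
    have "(s \<otimes> a) \<otimes> (t \<otimes> b) \<in> one_plus A P"
      using st one_plus_mult[OF pre] by blast
    then obtain r where r: "r \<in> P" "(s \<otimes> a) \<otimes> (t \<otimes> b) \<in> \<one> \<boxplus> r"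
      by (auto simp: one_plus_def)
    have rc: "r \<in> carrier A"
      using r preorder_carrier[OF pre] by auto
    have "r \<in> \<boxminus> \<one> \<boxplus> (s \<otimes> a) \<otimes> (t \<otimes> b)"
      using hadd_reversible[of "(s \<otimes> a) \<otimes> (t \<otimes> b)" \<one> r] r rc c ab by simp
    then have "\<boxminus> \<one> \<in> r \<boxplus> \<boxminus> ((s \<otimes> a) \<otimes> (t \<otimes> b))"
      using hadd_reversible[of r "\<boxminus> \<one>" "(s \<otimes> a) \<otimes> (t \<otimes> b)"] rc c ab hneg_closed by simp
    moreover have "(s \<otimes> a) \<otimes> (t \<otimes> b) = (s \<otimes> t) \<otimes> (a \<otimes> b)"
      using c ab by (simp add: m_ac)
    then have "\<boxminus> ((s \<otimes> a) \<otimes> (t \<otimes> b)) = (s \<otimes> t) \<otimes> \<boxminus> (a \<otimes> b)"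
      using c ab by (simp add: hneg_mult_right)
    moreover have "(s \<otimes> t) \<otimes> \<boxminus> (a \<otimes> b) \<in> P"
      using st neg preorder_mult[OF pre] by blast
    ultimately show False
      using r m1 preorder_hadd[OF pre] by metis
  qed
  have total: "a \<in> P \<or> \<boxminus> a \<in> P" if a: "a \<in> carrier A" for a
  proof (rule ccontr)
    \<comment> \<open>Otherwise primality applies to \<open>a\<close> and \<open>-a\<close>, whose product is minus a square.\<close>
    assume "\<not> ?thesis"
    then have "\<boxminus> (a \<otimes> \<boxminus> a) \<notin> P"
      using prime[of a "\<boxminus> a"] a hneg_closed by (simp add: hneg_hneg)
    then show False
      using a preorder_square[OF pre] hneg_closed by (simp add: hneg_mult_right hneg_hneg)
  qed
  show ?thesis
    using sign_of_ordering[OF P(1) total prime] sper_mono[OF P(2)] by blast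
qed

end

section \<open>Separation in von Neumann hyperrings\<close>

lemma sperD:
  assumes "\<sigma> \<in> sper A T"
  shows "\<sigma> \<one>\<^bsub>A\<^esub> = 1" "\<sigma> \<zero>\<^bsub>A\<^esub> = 0"
    and "\<And>a. a \<in> carrier A \<Longrightarrow> \<sigma> (\<boxminus>\<^bsub>A\<^esub> a) = - \<sigma> a"
    and "\<And>a b. \<lbrakk>a \<in> carrier A; b \<in> carrier A\<rbrakk> \<Longrightarrow> \<sigma> (a \<otimes>\<^bsub>A\<^esub> b) = \<sigma> a * \<sigma> b"
    and "\<And>a b c. \<lbrakk>a \<in> carrier A; b \<in> carrier A; c \<in> carrier A; a \<in> b \<boxplus>\<^bsub>A\<^esub> c\<rbrakk>
      \<Longrightarrow> \<sigma> a \<in> \<sigma> b \<boxplus>\<^bsub>three\<^esub> \<sigma> c"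
    and "\<And>a. a \<in> carrier A \<Longrightarrow> \<sigma> a \<in> {-1, 0, 1}"
    and "\<And>t. t \<in> T \<Longrightarrow> \<sigma> t \<in> {0, 1}"
  using assms by (auto simp: sper_def multiring_hom_def hom_def three_def)

lemma (in multiring) sper_one_plus:
  assumes T: "multiring_preorder A T" and "\<sigma> \<in> sper A T" "s \<in> one_plus A T"
  shows "\<sigma> s = 1"
proof -
  obtain t where t: "t \<in> T" "s \<in> \<one> \<boxplus> t"
    using assms by (auto simp: one_plus_def)
  then have "\<sigma> s \<in> 1 \<boxplus>\<^bsub>three\<^esub> \<sigma> t"
    using sperD(5)[OF assms(2), of s \<one> t] sperD(1)[OF assms(2)] preorder_carrier[OF T]
      hadd_in_carrier[of s \<one> t] by simp
  then show ?thesis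
    using sperD(7)[OF assms(2) t(1)] by (auto simp: three_def split: if_splits)
qed

context von_neumann_hyperring
begin

text \<open>Half of a Positivstellensatz: only $a$ is scaled by $1+T$. The asymmetry is what allows
  localizing at $a$ alone; the other half is the same lemma with $a$ and $b$ exchanged.\<close>

lemma separation:
  assumes T: "multiring_preorder A T" and ab: "a \<in> carrier A" "b \<in> carrier A"
    and eq: "\<And>\<sigma>. \<sigma> \<in> sper A T \<Longrightarrow> \<sigma> a = \<sigma> b"
  shows "\<exists>t \<in> one_plus A T. \<exists>q \<in> T. a \<otimes> t = b \<otimes> q"
proof -
  obtain c where c: "c \<in> carrier A" and ac: "a = (a \<otimes> a) \<otimes> c"
    using von_neumann ab by blast
  define x where "x = a \<otimes> b"
  define V where "V = adjoin A T (\<boxminus> x)"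
  define U where "U = {y \<in> carrier A. (a \<otimes> a) \<otimes> y \<in> V}"
  have x: "x \<in> carrier A" "\<boxminus> x \<in> carrier A"
    using ab hneg_closed by (auto simp: x_def)
  note V = adjoin_preorder[OF T x(2), folded V_def]
  note pm = preorder_mult[OF V(1)]
  have U: "multiring_preorder A U"
    unfolding U_def by (rule preorder_localize[OF V(1) ab(1) c ac])
  have VU: "V \<subseteq> U"
    using pm preorder_square[OF V(1) ab(1)] preorder_carrier[OF V(1)] by (auto simp: U_def)
  have "\<boxminus> \<one> \<in> U"
  proof (rule ccontr)
    assume "\<boxminus> \<one> \<notin> U"
    then obtain \<sigma> where \<sigma>: "\<sigma> \<in> sper A U"
      using sper_nonempty U unfolding proper_preorder_def by blast
    note \<sigma>D = sperD[OF \<sigma>]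
    have nac: "\<boxminus> (a \<otimes> c) \<in> carrier A"
      using ab c hneg_closed by simp
    \<comment> \<open>There is an element \<open>f\<close> of $1 - ac$ that annihilates $a$: both signs of it lie in \<open>U\<close>, so \<open>\<sigma>\<close>
      kills it, and \<open>\<sigma>\<close> is nonzero at $ac$.\<close>
    have "\<boxminus> (a \<otimes> c) \<otimes> a = \<boxminus> ((a \<otimes> a) \<otimes> c)"
      using ab c by (simp add: hneg_mult m_ac)
    then have "\<zero> \<in> \<one> \<otimes> a \<boxplus> \<boxminus> (a \<otimes> c) \<otimes> a"
      using zero_in_hadd_hneg ab ac by simp
    then obtain f where f: "f \<in> \<one> \<boxplus> \<boxminus> (a \<otimes> c)" "\<zero> = f \<otimes> a"
      using hadd_mult_converse[of \<one> "\<boxminus> (a \<otimes> c)" a \<zero>] ab nac by blast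
    have fc: "f \<in> carrier A"
      using hadd_in_carrier[OF f(1)] nac by simp
    have "(a \<otimes> a) \<otimes> f = a \<otimes> (f \<otimes> a)"
      using ab fc by (simp add: m_ac)
    also have "\<dots> = \<zero>"
      using f ab mult_hzero by simp
    finally have aaf: "(a \<otimes> a) \<otimes> f = \<zero>" .
    then have "f \<in> U" "\<boxminus> f \<in> U"
      using fc ab preorder_zero[OF V(1)] by (simp_all add: U_def hneg_closed hneg_mult_right hneg_zero)
    then have "\<sigma> f = 0"
      using \<sigma>D(7)[of f] \<sigma>D(7)[of "\<boxminus> f"] \<sigma>D(3)[OF fc] by auto
    then have "\<sigma> (\<boxminus> (a \<otimes> c)) = - 1"
      using \<sigma>D(5)[OF fc one_closed nac f(1)] \<sigma>D(1) \<sigma>D(6)[OF nac]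
      by (auto simp: three_def split: if_splits)
    then have "\<sigma> a \<noteq> 0"
      using \<sigma>D(3,4) ab c by auto
    moreover have "\<sigma> a = \<sigma> b"
      using eq sper_mono[of T U] V(2) VU \<sigma> by blast
    moreover have "- (\<sigma> a * \<sigma> b) \<in> {0, 1}"
      using \<sigma>D(7)[of "\<boxminus> x"] V(3) VU \<sigma>D(3)[OF x(1)] \<sigma>D(4)[OF ab] by (auto simp: x_def)
    ultimately show False
      using \<sigma>D(6)[OF ab(1)] by auto
  qed
  then have "\<boxminus> (a \<otimes> a) \<in> V"
    using ab by (simp add: U_def hneg_mult_right)
  then obtain p q where pq: "p \<in> T" "q \<in> T" "\<boxminus> (a \<otimes> a) \<in> p \<boxplus> q \<otimes> \<boxminus> x"
    unfolding V_def adjoin_def by blast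
  have pqc: "p \<in> carrier A" "q \<in> carrier A"
    using pq preorder_carrier[OF T] by auto
  have "a \<otimes> a \<in> \<boxminus> p \<boxplus> q \<otimes> x"
    using hneg_hadd[OF _ _ pq(3)] pqc x ab by (simp add: hneg_mult_right hneg_hneg hneg_closed)
  then have "q \<otimes> x \<in> \<boxminus> (\<boxminus> p) \<boxplus> a \<otimes> a"
    using hadd_reversible[of "a \<otimes> a" "\<boxminus> p" "q \<otimes> x"] pqc x ab hneg_closed by simp
  then have "q \<otimes> x \<in> a \<otimes> a \<boxplus> p"
    using pqc ab hadd_commute by (simp add: hneg_hneg)
  \<comment> \<open>Multiplication by $a c^2$ turns $a^2$ into $a$.\<close>
  then have "(q \<otimes> x) \<otimes> (a \<otimes> (c \<otimes> c)) \<in>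
      (a \<otimes> a) \<otimes> (a \<otimes> (c \<otimes> c)) \<boxplus> p \<otimes> (a \<otimes> (c \<otimes> c))"
    using hadd_mult pqc x ab c by simp
  moreover have "(a \<otimes> a) \<otimes> (a \<otimes> (c \<otimes> c)) = (((a \<otimes> a) \<otimes> c) \<otimes> a) \<otimes> c"
    using ab c by (simp add: m_ac)
  then have "(a \<otimes> a) \<otimes> (a \<otimes> (c \<otimes> c)) = \<one> \<otimes> a"
    using ac ab by simp
  moreover have "p \<otimes> (a \<otimes> (c \<otimes> c)) = (p \<otimes> (c \<otimes> c)) \<otimes> a"
    using pqc ab c by (simp add: m_ac)
  ultimately obtain t where t: "t \<in> \<one> \<boxplus> p \<otimes> (c \<otimes> c)" "(q \<otimes> x) \<otimes> (a \<otimes> (c \<otimes> c)) = t \<otimes> a"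
    using hadd_mult_converse[of \<one> "p \<otimes> (c \<otimes> c)" a "(q \<otimes> x) \<otimes> (a \<otimes> (c \<otimes> c))"] pqc ab c by auto
  have pc: "p \<otimes> (c \<otimes> c) \<in> T"
    using pq c preorder_mult[OF T] preorder_square[OF T] by blast
  have tc: "t \<in> carrier A"
    using hadd_in_carrier[OF t(1)] pqc c by simp
  have "a \<otimes> t = b \<otimes> (q \<otimes> ((a \<otimes> a) \<otimes> (c \<otimes> c)))"
    using t(2) tc ab c pqc by (simp add: x_def m_ac)
  moreover have "q \<otimes> ((a \<otimes> a) \<otimes> (c \<otimes> c)) \<in> T"
    using pq ab c preorder_mult[OF T] preorder_square[OF T] by blast
  ultimately show ?thesis
    using t(1) pc unfolding one_plus_def by blast
qed

lemma hat_eq_iff_marshall: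
  assumes T: "multiring_preorder A T" and ab: "a \<in> carrier A" "b \<in> carrier A"
  shows "hat A T a = hat A T b \<longleftrightarrow> (a, b) \<in> marshall_rel A (one_plus A T)"
proof
  assume "(a, b) \<in> marshall_rel A (one_plus A T)"
  then obtain s t where st: "s \<in> one_plus A T" "t \<in> one_plus A T" "a \<otimes> s = b \<otimes> t"
    by (auto simp: marshall_rel_def)
  have "s \<in> carrier A" "t \<in> carrier A"
    using st one_plus_subset[OF T] preorder_carrier[OF T] by blast+
  then have "\<sigma> a = \<sigma> b" if "\<sigma> \<in> sper A T" for \<sigma>
    using sperD(4)[OF that, of a s] sperD(4)[OF that, of b t] sper_one_plus[OF T that] st ab by simp
  then show "hat A T a = hat A T b"
    unfolding hat_def by (intro restrict_ext)
next
  assume "hat A T a = hat A T b"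
  then have eq: "\<sigma> a = \<sigma> b" if "\<sigma> \<in> sper A T" for \<sigma>
    using that unfolding hat_def by (metis restrict_apply')
  obtain t q where tq: "t \<in> one_plus A T" "q \<in> T" "a \<otimes> t = b \<otimes> q"
    using separation[OF T ab] eq by blast
  obtain u r where ur: "u \<in> one_plus A T" "r \<in> T" "b \<otimes> u = a \<otimes> r"
    using separation[OF T ab(2,1)] eq by metis
  note c = preorder_carrier[OF T]
  have tqc: "t \<in> carrier A" "q \<in> carrier A" "u \<in> carrier A" "r \<in> carrier A"
    using tq ur one_plus_subset[OF T] c by auto
  have tu: "t \<otimes> u \<in> one_plus A T" and rt: "r \<otimes> t \<in> T" and qu: "q \<otimes> u \<in> T"
    using tq ur one_plus_mult[OF T] one_plus_subset[OF T] preorder_mult[OF T] by blast+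
  \<comment> \<open>With $at = bq$ and $bu = ar$, both $a(tu + rt)$ and $b(qu + tu)$ are $atu + btu$.\<close>
  have eq1: "(t \<otimes> u) \<otimes> a = (q \<otimes> u) \<otimes> b"
  proof -
    have "(t \<otimes> u) \<otimes> a = (a \<otimes> t) \<otimes> u"
      using tqc ab by (simp add: m_ac)
    also have "\<dots> = (q \<otimes> u) \<otimes> b"
      unfolding tq(3) using tqc ab by (simp add: m_ac)
    finally show ?thesis .
  qed
  have eq2: "(t \<otimes> u) \<otimes> b = (r \<otimes> t) \<otimes> a"
  proof -
    have "(t \<otimes> u) \<otimes> b = (b \<otimes> u) \<otimes> t"
      using tqc ab by (simp add: m_ac)
    also have "\<dots> = (r \<otimes> t) \<otimes> a"
      unfolding ur(3) using tqc ab by (simp add: m_ac)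
    finally show ?thesis .
  qed
  obtain y where y: "y \<in> (t \<otimes> u) \<otimes> a \<boxplus> (r \<otimes> t) \<otimes> a"
    using hadd_nonempty[of "(t \<otimes> u) \<otimes> a" "(r \<otimes> t) \<otimes> a"] tqc ab by auto
  obtain v where v: "v \<in> t \<otimes> u \<boxplus> r \<otimes> t" "y = v \<otimes> a"
    using hadd_mult_converse[OF _ _ _ y] tqc ab by auto
  have "y \<in> (t \<otimes> u) \<otimes> b \<boxplus> (q \<otimes> u) \<otimes> b"
    using y hadd_commute[of "(q \<otimes> u) \<otimes> b" "(t \<otimes> u) \<otimes> b"] eq1 eq2 tqc ab by simp
  then obtain w where w: "w \<in> t \<otimes> u \<boxplus> q \<otimes> u" "y = w \<otimes> b"
    using hadd_mult_converse[of "t \<otimes> u" "q \<otimes> u" b y] tqc ab by auto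
  have vw: "v \<in> one_plus A T" "w \<in> one_plus A T"
    using one_plus_hadd[OF T tu rt v(1)] one_plus_hadd[OF T tu qu w(1)] by auto
  have "a \<otimes> v = b \<otimes> w"
    using v(2) w(2) ab vw one_plus_subset[OF T] c m_comm by metis
  then show "(a, b) \<in> marshall_rel A (one_plus A T)"
    using ab vw by (intro marshall_relI)
qed

end

section \<open>The isomorphism\<close>

theorem theorem3p13:
  fixes A :: "('a, 'm) multiring_scheme" and T :: "'a set"
  assumes "von_neumann_hyperring A"
    and "proper_preorder A T"
  shows "\<exists>f \<in> multiring_iso (marshall_quot A (one_plus A T)) (Q_quot A T).
    (\<forall>a \<in> carrier A. f (marshall_class A (one_plus A T) a) = hat A T a) \<and>
    (\<forall>g \<in> multiring_hom (marshall_quot A (one_plus A T)) (Q_quot A T).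
       (\<forall>a \<in> carrier A. g (marshall_class A (one_plus A T) a) = hat A T a) \<longrightarrow>
       (\<forall>x \<in> carrier (marshall_quot A (one_plus A T)). g x = f x))"
proof -
  interpret von_neumann_hyperring A by fact
  have T: "multiring_preorder A T"
    using assms(2) by (simp add: proper_preorder_def)
  define S where "S = one_plus A T"
  let ?M = "marshall_quot A S" and ?Q = "Q_quot A T"
  let ?cl = "marshall_class A S" and ?h = "hat A T"
  have S: "S \<subseteq> carrier A" "\<one>\<^bsub>A\<^esub> \<in> S" "\<And>s t. \<lbrakk>s \<in> S; t \<in> S\<rbrakk> \<Longrightarrow> s \<otimes>\<^bsub>A\<^esub> t \<in> S"
    unfolding S_def using one_plus_subset[OF T] preorder_carrier[OF T] one_in_one_plus[OF T]
      one_plus_mult[OF T] by blast+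
  have cl_iff: "?cl a = ?cl b \<longleftrightarrow> ?h a = ?h b" if "a \<in> carrier A" "b \<in> carrier A" for a b
    using marshall_class_eq_iff[OF S that] hat_eq_iff_marshall[OF T that] by (simp add: S_def)
  have carM: "carrier ?M = ?cl ` carrier A"
    by (auto simp: marshall_quot_def marshall_class_def quotient_def)
  have carQ: "carrier ?Q = ?h ` carrier A"
    by (simp add: Q_quot_def)
  define f where "f X = ?h (inv_into (carrier A) ?cl X)" for X
  define g where "g F = ?cl (inv_into (carrier A) ?h F)" for F
  have f: "f (?cl a) = ?h a" if "a \<in> carrier A" for a
    using inv_into_into[of "?cl a" ?cl "carrier A"] f_inv_into_f[of "?cl a" ?cl "carrier A"]
      cl_iff[OF _ that, of "inv_into (carrier A) ?cl (?cl a)"] that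
    unfolding f_def by simp
  have g: "g (?h a) = ?cl a" if "a \<in> carrier A" for a
    using inv_into_into[of "?h a" ?h "carrier A"] f_inv_into_f[of "?h a" ?h "carrier A"]
      cl_iff[OF _ that, of "inv_into (carrier A) ?h (?h a)"] that
    unfolding g_def by simp
  \<comment> \<open>This carries a sum rescaled by \<open>S\<close> to a sum of the unscaled images.\<close>
  have hatS: "?h (a \<otimes>\<^bsub>A\<^esub> s) = ?h a" if as: "a \<in> carrier A" "s \<in> S" for a s
  proof -
    have "s \<in> carrier A"
      using that S by blast
    then have "\<sigma> (a \<otimes>\<^bsub>A\<^esub> s) = \<sigma> a" if "\<sigma> \<in> sper A T" for \<sigma>
      using sperD(4)[OF that] sper_one_plus[OF T that] as by (simp add: S_def)
    then show ?thesis
      unfolding hat_def by (intro restrict_ext)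
  qed
  have Qadd: "?h a \<in> ?h b \<boxplus>\<^bsub>?Q\<^esub> ?h c"
    if "a \<in> carrier A" "b \<in> carrier A" "c \<in> carrier A" "a \<in> b \<boxplus>\<^bsub>A\<^esub> c" for a b c
    using that by (simp add: Q_quot_def) (intro exI conjI, (rule refl | assumption)+)
  have Madd: "?cl a \<in> ?cl b \<boxplus>\<^bsub>?M\<^esub> ?cl c"
    if "a \<in> carrier A" "b \<in> carrier A" "c \<in> carrier A"
      "s \<in> S" "t \<in> S" "u \<in> S" "a \<otimes>\<^bsub>A\<^esub> s \<in> b \<otimes>\<^bsub>A\<^esub> t \<boxplus>\<^bsub>A\<^esub> c \<otimes>\<^bsub>A\<^esub> u" for a b c s t u
    using that unfolding marshall_quot_def multiring.simps mem_Collect_eq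
    by (intro exI[of _ a] exI[of _ b] exI[of _ c]) blast
  note Mm = marshall_quot_mult[OF S] and Mn = marshall_quot_hneg[OF S]
  have "f X \<in> f Y \<boxplus>\<^bsub>?Q\<^esub> f Z" if XYZ: "X \<in> Y \<boxplus>\<^bsub>?M\<^esub> Z" for X Y Z
  proof -
    obtain a b c s t u where abc: "a \<in> carrier A" "b \<in> carrier A" "c \<in> carrier A"
      "X = ?cl a" "Y = ?cl b" "Z = ?cl c" and stu: "s \<in> S" "t \<in> S" "u \<in> S"
      "a \<otimes>\<^bsub>A\<^esub> s \<in> b \<otimes>\<^bsub>A\<^esub> t \<boxplus>\<^bsub>A\<^esub> c \<otimes>\<^bsub>A\<^esub> u"
      using XYZ by (auto simp: marshall_quot_def)
    have "s \<in> carrier A" "t \<in> carrier A" "u \<in> carrier A"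
      using stu S by auto
    then have "?h (a \<otimes>\<^bsub>A\<^esub> s) \<in> ?h (b \<otimes>\<^bsub>A\<^esub> t) \<boxplus>\<^bsub>?Q\<^esub> ?h (c \<otimes>\<^bsub>A\<^esub> u)"
      using Qadd abc stu by simp
    then show ?thesis
      using abc stu f hatS by simp
  qed
  moreover have "f \<zero>\<^bsub>?M\<^esub> = \<zero>\<^bsub>?Q\<^esub>" "f \<one>\<^bsub>?M\<^esub> = \<one>\<^bsub>?Q\<^esub>"
    using f by (simp_all add: marshall_quot_def Q_quot_def hzero_closed)
  moreover have "f (X \<otimes>\<^bsub>?M\<^esub> Y) = f X \<otimes>\<^bsub>?Q\<^esub> f Y"
    if "X \<in> carrier ?M" "Y \<in> carrier ?M" for X Y
    using that unfolding carM by (elim imageE) (simp add: f Mm Q_quot_mult)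
  moreover have "f (\<boxminus>\<^bsub>?M\<^esub> X) = \<boxminus>\<^bsub>?Q\<^esub> (f X)" if "X \<in> carrier ?M" for X
    using that unfolding carM by (elim imageE) (simp add: f Mn Q_quot_hneg hneg_closed)
  moreover have "f \<in> carrier ?M \<rightarrow> carrier ?Q"
    using f by (auto simp: carM carQ)
  ultimately have fhom: "f \<in> multiring_hom ?M ?Q"
    unfolding multiring_hom_def hom_def by blast
  have "g F \<in> g G \<boxplus>\<^bsub>?M\<^esub> g H" if FGH: "F \<in> G \<boxplus>\<^bsub>?Q\<^esub> H" for F G H
  proof -
    obtain a b c where abc: "a \<in> carrier A" "b \<in> carrier A" "c \<in> carrier A"
      "F = ?h a" "G = ?h b" "H = ?h c" "a \<in> b \<boxplus>\<^bsub>A\<^esub> c"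
      using FGH by (auto simp: Q_quot_def)
    then have "a \<otimes>\<^bsub>A\<^esub> \<one>\<^bsub>A\<^esub> \<in> b \<otimes>\<^bsub>A\<^esub> \<one>\<^bsub>A\<^esub> \<boxplus>\<^bsub>A\<^esub> c \<otimes>\<^bsub>A\<^esub> \<one>\<^bsub>A\<^esub>"
      by simp
    then have "?cl a \<in> ?cl b \<boxplus>\<^bsub>?M\<^esub> ?cl c"
      using Madd abc S(2) by blast
    then show ?thesis
      using abc g by simp
  qed
  moreover have "g \<zero>\<^bsub>?Q\<^esub> = \<zero>\<^bsub>?M\<^esub>" "g \<one>\<^bsub>?Q\<^esub> = \<one>\<^bsub>?M\<^esub>"
    using g by (simp_all add: marshall_quot_def Q_quot_def hzero_closed)
  moreover have "g (X \<otimes>\<^bsub>?Q\<^esub> Y) = g X \<otimes>\<^bsub>?M\<^esub> g Y"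
    if "X \<in> carrier ?Q" "Y \<in> carrier ?Q" for X Y
    using that unfolding carQ by (elim imageE) (simp add: g Mm Q_quot_mult)
  moreover have "g (\<boxminus>\<^bsub>?Q\<^esub> X) = \<boxminus>\<^bsub>?M\<^esub> (g X)" if "X \<in> carrier ?Q" for X
    using that unfolding carQ by (elim imageE) (simp add: g Mn Q_quot_hneg hneg_closed)
  moreover have "g \<in> carrier ?Q \<rightarrow> carrier ?M"
    using g by (auto simp: carM carQ)
  ultimately have ghom: "g \<in> multiring_hom ?Q ?M"
    unfolding multiring_hom_def hom_def by blast
  have "f \<in> multiring_iso ?M ?Q"
    using fhom ghom f g by (auto simp: multiring_iso_def carM carQ intro!: bexI[of _ g])
  moreover have "\<forall>k \<in> multiring_hom ?M ?Q. (\<forall>a \<in> carrier A. k (?cl a) = ?h a) \<longrightarrow>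
      (\<forall>x \<in> carrier ?M. k x = f x)"
    using f by (auto simp: carM)
  ultimately show ?thesis
    using f unfolding S_def by blast
qed

end
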